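(* Let $\tilde A$ be a $d\times d$ real isotropic matrix with $|\det\tilde A|=1$. Then $$\tilde A=QUQ^{-1},$$ where $U$ is an orthogonal matrix and $Q$ is a (real) positive definite symmetric matrix.
   Context: A square matrix is called isotropic if it is diagonalizable over $\mathbb C$ and all its eigenvalues are equal in absolute value. *)

theory Defs
  imports "HOL-Analysis.Analysis"
begin

definition diagonal_matrix :: "'a::zero ^'n^'n \<Rightarrow> bool" where
  "diagonal_matrix D \<longleftrightarrow> (\<forall>i j. i \<noteq> j \<longrightarrow> D $ i $ j = 0)"

definition diagonalizable :: "'a::field ^'n^'n \<Rightarrow> bool" where
  "diagonalizable A \<longleftrightarrow>
     (\<exists>(P :: 'a ^'n^'n) (D :: 'a ^'n^'n). invertible P \<and> diagonal_matrix D \<and> A = P ** D ** matrix_inv P)"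

definition eigenvalue :: "'a::field ^'n^'n \<Rightarrow> 'a \<Rightarrow> bool" where
  "eigenvalue A c \<longleftrightarrow> (\<exists>v. v \<noteq> 0 \<and> A *v v = c *s v)"

text \<open>The definition is on complex matrices, so that both diagonalizability and the
  eigenvalues are taken over the complex numbers; a real matrix \<open>A\<close> is isotropic when
  \<open>map_matrix complex_of_real A\<close> is.\<close>

definition isotropic :: "complex ^'n^'n \<Rightarrow> bool" where
  "isotropic A \<longleftrightarrow> diagonalizable A \<and>
     (\<forall>c c'. eigenvalue A c \<longrightarrow> eigenvalue A c' \<longrightarrow> cmod c = cmod c')"

definition symmetric_matrix :: "'a ^'n^'n \<Rightarrow> bool" where
  "symmetric_matrix Q \<longleftrightarrow> transpose Q = Q"

definition positive_definite :: "real ^'n^'n \<Rightarrow> bool" where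
  "positive_definite Q \<longleftrightarrow> (\<forall>x. x \<noteq> 0 \<longrightarrow> x \<bullet> (Q *v x) > 0)"

end

(* If A = P D P^-1 over the complex numbers, then |det A| = 1 forces all diagonal entries of D to
   have modulus 1, so the real inner product <P^-1 x, P^-1 y> on real vectors is A-invariant.
   Writing it as (S x) \<bullet> (S y) with S symmetric positive definite makes S A S^-1 orthogonal, and
   Q = S^-1 works. *)
theory Submission
  imports Defs
begin

section \<open>Square roots of positive definite operators\<close>

text \<open>For \<open>norm B < 1\<close> and \<open>B\<close> self-adjoint, \<open>(I - Y)\<^sup>2 = I - B\<close> says that \<open>Y\<close> is a fixed point of
  \<open>Y \<mapsto> (B + Y\<^sup>2) / 2\<close>, a contraction of the self-adjoint part of the ball of radius \<open>norm B\<close>.\<close>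

lemma self_adjoint_fixpoint:
  fixes B :: "'a::{real_inner,banach} \<Rightarrow>\<^sub>L 'a"
  assumes q: "norm B \<le> q" "q < 1" and B: "\<And>x y. B x \<bullet> y = x \<bullet> B y"
  obtains Y :: "'a \<Rightarrow>\<^sub>L 'a" where "norm Y \<le> q" "\<And>x y. Y x \<bullet> y = x \<bullet> Y y"
    "\<And>x. 2 *\<^sub>R Y x = B x + Y (Y x)"
proof -
  \<comment> \<open>Self-adjointness is built into \<open>K\<close> so that the fixed point inherits
    it. It is a closed condition on \<open>Y\<close>, so \<open>K\<close> stays complete.\<close>
  define K where "K = cball (0 :: 'a \<Rightarrow>\<^sub>L 'a) q \<inter> {Y :: 'a \<Rightarrow>\<^sub>L 'a. \<forall>x y. Y x \<bullet> y = x \<bullet> Y y}"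
  define F where "F Y = (1/2) *\<^sub>R (B + (Y o\<^sub>L Y))" for Y :: "'a \<Rightarrow>\<^sub>L 'a"
  have q0: "0 \<le> q" using q norm_ge_zero order_trans by blast
  have "closed {Y :: 'a \<Rightarrow>\<^sub>L 'a. \<forall>x y. Y x \<bullet> y = x \<bullet> Y y}"
    by (intro closed_Collect_all closed_Collect_eq continuous_intros)
  then have "complete K"
    unfolding K_def complete_eq_closed by (intro closed_Int closed_cball)
  moreover have "0 \<in> K"
    using q0 by (simp add: K_def)
  moreover have "F Y \<in> K" if "Y \<in> K" for Y
  proof -
    have Y: "norm Y \<le> q" "\<And>x y. Y x \<bullet> y = x \<bullet> Y y"
      using that by (auto simp: K_def)
    have "norm (Y o\<^sub>L Y) \<le> q * q"
      using norm_blinfun_compose[of Y Y] mult_mono[OF Y(1) Y(1) q0] by simp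
    also have "\<dots> \<le> q * 1"
      using q q0 by (intro mult_left_mono) auto
    finally have "norm (B + (Y o\<^sub>L Y)) \<le> 2 * q"
      using norm_triangle_ineq[of B "Y o\<^sub>L Y"] q by linarith
    then show ?thesis
      using Y B by (simp add: K_def F_def blinfun.bilinear_simps inner_simps)
  qed
  moreover have "dist (F Y) (F Z) \<le> q * dist Y Z" if "Y \<in> K" "Z \<in> K" for Y Z
  proof -
    have YZ: "norm Y \<le> q" "norm Z \<le> q"
      using that by (auto simp: K_def)
    \<comment> \<open>\<open>Y\<close> and \<open>Z\<close> need not commute, so the difference of
      their squares is split as Y(Y - Z) + (Y - Z)Z. Each summand has norm at most
      \<open>q * norm (Y - Z)\<close>, and the factor 1/2 absorbs the two copies.\<close>
    have "F Y - F Z = (1/2) *\<^sub>R ((Y o\<^sub>L (Y - Z)) + ((Y - Z) o\<^sub>L Z))"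
      by (rule blinfun_eqI) (simp add: F_def blinfun.bilinear_simps algebra_simps)
    moreover have "norm ((Y o\<^sub>L (Y - Z)) + ((Y - Z) o\<^sub>L Z)) \<le> q * norm (Y - Z) + norm (Y - Z) * q"
      using YZ by (intro norm_triangle_le add_mono order_trans[OF norm_blinfun_compose] mult_mono) (auto simp: q0)
    ultimately show ?thesis
      by (simp add: dist_norm)
  qed
  ultimately obtain Y where "Y \<in> K" and Y: "F Y = Y"
    using Banach_fix[of K q F] q q0 by blast
  show ?thesis
  proof
    show "norm Y \<le> q" "\<And>x y. Y x \<bullet> y = x \<bullet> Y y"
      using \<open>Y \<in> K\<close> by (auto simp: K_def)
    have "2 *\<^sub>R F Y = B + (Y o\<^sub>L Y)"
      by (simp add: F_def)
    then show "2 *\<^sub>R Y x = B x + Y (Y x)" for x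
      unfolding Y by (metis blinfun.add_left blinfun.scaleR_left blinfun_apply_blinfun_compose)
  qed
qed

text \<open>For a suitable scale t, the operator B = I - t f has norm below 1, so the fixed point Y
  satisfies (I - Y)^2 = I - B = t f, and (I - Y) / sqrt t is the desired root. It is positive
  because Y also has norm below 1. This uses completeness only and avoids the spectral theorem; the
  uniform bound \<open>m\<close> stands in for positive definiteness.\<close>

lemma coercive_sqrt:
  fixes f :: "'a::{real_inner,banach} \<Rightarrow> 'a"
  assumes f: "bounded_linear f" "\<And>x y. f x \<bullet> y = x \<bullet> f y"
    and m: "0 < m" "\<And>x. m * (norm x)\<^sup>2 \<le> x \<bullet> f x"
  obtains s where "bounded_linear s" "\<And>x y. s x \<bullet> y = x \<bullet> s y"
    "\<And>x. x \<noteq> 0 \<Longrightarrow> 0 < x \<bullet> s x" "\<And>x. s (s x) = f x"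
proof -
  interpret f: bounded_linear f by fact
  \<comment> \<open>Taking the maximum with \<open>m\<close> ensures m \<le> M, so that 1 - m^2 /
    M^2 below is nonnegative and has a real square root.\<close>
  obtain M where M: "m \<le> M" "\<And>x. norm (f x) \<le> M * norm x"
  proof -
    obtain M0 where "\<And>x. norm (f x) \<le> norm x * M0" using f.bounded by blast
    moreover have "norm x * M0 \<le> max m M0 * norm x" for x
      by (subst mult.commute) (intro mult_right_mono, auto)
    ultimately show ?thesis
      using order_trans by (intro that[of "max m M0"]) (simp, blast)
  qed
  have M0: "0 < M" using m M by linarith
  define t where "t = m / M\<^sup>2"
  have t: "0 < t" using m M0 by (simp add: t_def)
  define q where "q = sqrt (1 - m\<^sup>2 / M\<^sup>2)"
  have "m\<^sup>2 \<le> M\<^sup>2" using m M by (intro power_mono) auto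
  then have q2: "q\<^sup>2 = 1 - m\<^sup>2 / M\<^sup>2" "0 \<le> q"
    using M0 by (auto simp: q_def)
  have "q < 1"
    using m M0 by (simp add: q_def)
  define B where "B = Blinfun (\<lambda>x. x - t *\<^sub>R f x)"
  have B: "B x = x - t *\<^sub>R f x" for x
    unfolding B_def
    by (subst bounded_linear_Blinfun_apply) (auto intro!: bounded_linear_intros f)
  \<comment> \<open>\<open>t\<close> minimises \<open>1 - 2 t m + t\<^sup>2 M\<^sup>2\<close>, with value \<open>q\<^sup>2\<close>.\<close>
  have "norm (B x) \<le> q * norm x" for x
  proof (rule power2_le_imp_le)
    have "(norm (B x))\<^sup>2 = (norm x)\<^sup>2 - 2 * t * (x \<bullet> f x) + t\<^sup>2 * (norm (f x))\<^sup>2"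
      unfolding B power2_norm_eq_inner
      by (simp add: inner_simps inner_commute algebra_simps power2_eq_square)
    also have "\<dots> \<le> (norm x)\<^sup>2 - 2 * t * (m * (norm x)\<^sup>2) + t\<^sup>2 * (M * norm x)\<^sup>2"
      using t m M by (intro add_mono diff_mono mult_left_mono power_mono) auto
    also have "\<dots> = (q * norm x)\<^sup>2"
      using M0 unfolding power_mult_distrib q2 t_def by (simp add: field_simps power2_eq_square)
    finally show "(norm (B x))\<^sup>2 \<le> (q * norm x)\<^sup>2" .
  qed (simp add: q2)
  then have "norm B \<le> q"
    using q2 by (intro norm_blinfun_bound)
  moreover have "B x \<bullet> y = x \<bullet> B y" for x y
    by (simp add: B inner_simps f)
  ultimately obtain Y :: "'a \<Rightarrow>\<^sub>L 'a" where Y: "norm Y \<le> q" "\<And>x y. Y x \<bullet> y = x \<bullet> Y y"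
    "\<And>x. 2 *\<^sub>R Y x = B x + Y (Y x)"
    using self_adjoint_fixpoint \<open>q < 1\<close> by metis
  define s where "s x = (1 / sqrt t) *\<^sub>R (x - Y x)" for x
  show ?thesis
  proof
    show "bounded_linear s"
      unfolding s_def by (intro bounded_linear_intros)
    show "s x \<bullet> y = x \<bullet> s y" for x y
      by (simp add: s_def inner_simps Y)
    show "0 < x \<bullet> s x" if "x \<noteq> 0" for x
    proof -
      have "x \<bullet> Y x \<le> norm x * norm (Y x)"
        by (rule norm_cauchy_schwarz)
      also have "\<dots> \<le> norm x * (q * norm x)"
        using Y(1) by (intro mult_left_mono order_trans[OF norm_blinfun] mult_right_mono) auto
      also have "\<dots> < norm x * (1 * norm x)"
        using that \<open>q < 1\<close> by (intro mult_strict_left_mono mult_strict_right_mono) auto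
      finally have "x \<bullet> Y x < x \<bullet> x"
        by (simp add: dot_square_norm power2_eq_square)
      then show ?thesis
        using t by (simp add: s_def inner_simps)
    qed
    show "s (s x) = f x" for x
    proof -
      have "s (s x) = (1 / sqrt t * (1 / sqrt t)) *\<^sub>R (x - Y x - Y (x - Y x))"
        by (simp add: s_def blinfun.bilinear_simps scaleR_diff_right)
      also have "\<dots> = (1 / t) *\<^sub>R (x - 2 *\<^sub>R Y x + Y (Y x))"
        using t by (simp add: blinfun.bilinear_simps scaleR_2)
      also have "\<dots> = f x"
        using t by (simp add: Y B)
      finally show ?thesis .
    qed
  qed
qed

section \<open>Invariant inner products\<close>

text \<open>\<open>S\<close> is the positive factor in the polar decomposition of \<open>L\<close>,
  the square root of L^T L. Injectivity in finite dimension bounds \<open>norm (L x)\<close> below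
  by a multiple of \<open>norm x\<close>, which makes L^T L coercive.\<close>

lemma pullback_inner_eq_symmetric:
  fixes L :: "real^'n \<Rightarrow> 'b::euclidean_space"
  assumes L: "linear L" "inj L"
  obtains S :: "real^'n^'n" where "symmetric_matrix S" "positive_definite S"
    "\<And>x y. (S *v x) \<bullet> (S *v y) = L x \<bullet> L y"
proof -
  obtain b where b: "b > 0" "\<And>x. b * norm x \<le> norm (L x)"
    using linear_inj_bounded_below_pos[OF L] by blast
  let ?f = "\<lambda>x. adjoint L (L x)"
  have adj: "x \<bullet> ?f y = L x \<bullet> L y" "?f x \<bullet> y = L x \<bullet> L y" for x y
    using adjoint_works[OF L(1)] by (auto simp: inner_commute)
  have "bounded_linear ?f"
    using linear_compose[OF L(1) adjoint_linear[OF L(1)]]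
    by (simp add: linear_conv_bounded_linear o_def)
  moreover have "b\<^sup>2 * (norm x)\<^sup>2 \<le> x \<bullet> ?f x" for x
    using power_mono[OF b(2), of x 2] b(1) by (simp add: adj dot_square_norm power_mult_distrib)
  ultimately obtain s where s: "bounded_linear s" "\<And>x y. s x \<bullet> y = x \<bullet> s y"
    "\<And>x. x \<noteq> 0 \<Longrightarrow> 0 < x \<bullet> s x" "\<And>x. s (s x) = ?f x"
    using coercive_sqrt[of ?f "b\<^sup>2"] b adj by (metis zero_less_power)
  have S: "matrix s *v x = s x" for x
    using fun_cong[OF matrix_vector_mul(3)[OF s(1)]] .
  show ?thesis
  proof
    have "(transpose (matrix s) *v x) \<bullet> y = (matrix s *v x) \<bullet> y" for x y
      by (simp add: dot_lmul_matrix S s(2))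
    then show "symmetric_matrix (matrix s)"
      unfolding symmetric_matrix_def by (metis matrix_eq vector_eq_rdot)
    show "positive_definite (matrix s)"
      by (simp add: positive_definite_def S s(3))
    show "(matrix s *v x) \<bullet> (matrix s *v y) = L x \<bullet> L y" for x y
      by (simp add: S s adj)
  qed
qed

lemma matrix_inv_inverse:
  fixes A :: "'a::field^'n^'n"
  assumes "invertible A"
  shows "A ** matrix_inv A = mat 1" "matrix_inv A ** A = mat 1"
  using assms someI_ex[of "\<lambda>B. A ** B = mat 1 \<and> B ** A = mat 1"]
  unfolding invertible_def matrix_inv_def by auto

lemma matrix_inv_eqI:
  fixes A :: "'a::field^'n^'n"
  assumes "A ** B = mat 1"
  shows "matrix_inv A = B"
proof -
  have "invertible A" using assms invertible_right_inverse by blast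
  then show ?thesis
    by (metis assms matrix_inv_inverse(2) matrix_mul_assoc matrix_mul_lid matrix_mul_rid)
qed

lemma positive_definite_invertible: "positive_definite S \<Longrightarrow> invertible S"
  unfolding positive_definite_def invertible_left_inverse matrix_left_invertible_ker
  by (metis inner_zero_right less_irrefl)

lemma symmetric_matrix_inv:
  fixes S :: "'a::field^'n^'n"
  assumes "symmetric_matrix S" "invertible S"
  shows "symmetric_matrix (matrix_inv S)"
proof -
  have "S ** transpose (matrix_inv S) = mat 1"
    using assms matrix_inv_inverse(2)[of S]
    by (metis matrix_transpose_mul symmetric_matrix_def transpose_mat)
  then show ?thesis
    unfolding symmetric_matrix_def using matrix_inv_eqI by metis
qed

text \<open>The substitution x = S y turns the quadratic form of the inverse at x into that of
  \<open>S\<close> at y.\<close>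

lemma positive_definite_inv:
  assumes "positive_definite S"
  shows "positive_definite (matrix_inv S)"
  unfolding positive_definite_def
proof (intro allI impI)
  fix x :: "real^'a" assume "x \<noteq> 0"
  define y where "y = matrix_inv S *v x"
  have x: "x = S *v y"
    using matrix_inv_inverse(1)[OF positive_definite_invertible[OF assms]]
    by (simp add: y_def matrix_vector_mul_assoc)
  then have "y \<noteq> 0" using \<open>x \<noteq> 0\<close> by auto
  then have "0 < y \<bullet> (S *v y)" using assms by (auto simp: positive_definite_def)
  then show "0 < x \<bullet> (matrix_inv S *v x)"
    by (simp add: x[symmetric] y_def[symmetric] inner_commute)
qed

text \<open>If |S y| = |L y| for all y, then |S A y| = |L A y| = |L y| = |S y|, so S A S^-1
  preserves norms. The codomain of \<open>L\<close> is left general so that a real \<open>A\<close>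
  can be measured in complex coordinates.\<close>

lemma invariant_inner_imp_orthogonal_conj:
  fixes A :: "real^'n^'n" and L :: "real^'n \<Rightarrow> 'b::euclidean_space"
  assumes L: "linear L" "inj L" and inv: "\<And>x. norm (L (A *v x)) = norm (L x)"
  shows "\<exists>(Q :: real ^'n^'n) (U :: real ^'n^'n).
           orthogonal_matrix U \<and> symmetric_matrix Q \<and> positive_definite Q \<and>
           A = Q ** U ** matrix_inv Q"
proof -
  obtain S :: "real^'n^'n" where S: "symmetric_matrix S" "positive_definite S"
    "\<And>x y. (S *v x) \<bullet> (S *v y) = L x \<bullet> L y"
    using pullback_inner_eq_symmetric[OF L] by blast
  note inv_S = positive_definite_invertible[OF S(2)]
  note SQ = matrix_inv_inverse[OF inv_S]
  define U where "U = S ** A ** matrix_inv S"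
  have "norm (U *v x) = norm x" for x
  proof -
    define y where "y = matrix_inv S *v x"
    have "norm (U *v x) = norm (S *v (A *v y))"
      by (simp add: U_def y_def matrix_vector_mul_assoc matrix_mul_assoc)
    also have "\<dots> = norm (L y)"
      using inv[of y] by (simp add: norm_eq_sqrt_inner S(3))
    also have "\<dots> = norm (S *v y)"
      by (simp add: norm_eq_sqrt_inner S(3))
    also have "S *v y = x"
      by (simp add: y_def matrix_vector_mul_assoc SQ)
    finally show ?thesis .
  qed
  then have "orthogonal_matrix U"
    using orthogonal_transformation_matrix[of "(*v) U"]
    by (simp add: orthogonal_transformation)
  moreover have "matrix_inv (matrix_inv S) = S"
    by (rule matrix_inv_eqI) (rule SQ)
  moreover have "matrix_inv S ** U ** S = A"
    unfolding U_def by (metis SQ(2) matrix_mul_assoc matrix_mul_lid matrix_mul_rid)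
  ultimately show ?thesis
    using symmetric_matrix_inv[OF S(1) inv_S] positive_definite_inv[OF S(2)] by metis
qed

section \<open>Isotropic matrices\<close>

lemma det_map_matrix_of_real:
  "det (map_matrix complex_of_real A) = complex_of_real (det A)"
  by (simp add: det_def)

lemma map_matrix_of_real_mult_vec:
  "map_matrix complex_of_real A *v (\<chi> i. of_real (x $ i)) = (\<chi> i. of_real ((A *v x) $ i))"
  by (simp add: vec_eq_iff matrix_vector_mult_def)

lemma diagonal_matrix_mult_vec:
  fixes D :: "'a::comm_ring_1^'n^'n"
  assumes "diagonal_matrix D"
  shows "(D *v x) $ i = D $ i $ i * x $ i"
proof -
  have "(D *v x) $ i = (\<Sum>j\<in>UNIV. if j = i then D $ i $ i * x $ i else 0)"
    unfolding matrix_vector_mult_def vec_lambda_beta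
    by (intro sum.cong) (use assms in \<open>auto simp: diagonal_matrix_def\<close>)
  then show ?thesis by simp
qed

text \<open>The k-th column of \<open>P\<close> is an eigenvector, nonzero because \<open>P\<close>
  is injective.\<close>

lemma eigenvalue_diagonalized:
  fixes P D :: "'a::field^'n^'n"
  assumes P: "invertible P" and D: "diagonal_matrix D"
  shows "eigenvalue (P ** D ** matrix_inv P) (D $ k $ k)"
proof -
  let ?e = "axis k 1 :: 'a^'n"
  have "P *v ?e \<noteq> 0"
    using inj_matrix_vector_mult[OF P]
    by (metis axis_eq_0_iff inj_eq matrix_vector_mult_0_right zero_neq_one)
  moreover have "D *v ?e = D $ k $ k *s ?e"
    by (auto simp: vec_eq_iff diagonal_matrix_mult_vec[OF D] axis_def)
  then have "(P ** D ** matrix_inv P) *v (P *v ?e) = D $ k $ k *s (P *v ?e)"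
    by (metis P matrix_inv_inverse(2) matrix_vector_mul_assoc matrix_vector_mul_lid
        vector_scalar_commute)
  ultimately show ?thesis
    unfolding eigenvalue_def by blast
qed

theorem theorem3p3:
  fixes A :: "real ^'n^'n"
  assumes "isotropic (map_matrix complex_of_real A)"
    and "\<bar>det A\<bar> = 1"
  shows "\<exists>(Q :: real ^'n^'n) (U :: real ^'n^'n).
           orthogonal_matrix U \<and> symmetric_matrix Q \<and> positive_definite Q \<and>
           A = Q ** U ** matrix_inv Q"
proof -
  obtain P D :: "complex^'n^'n" where P: "invertible P" and D: "diagonal_matrix D"
    and A: "map_matrix complex_of_real A = P ** D ** matrix_inv P"
    using assms(1) unfolding isotropic_def diagonalizable_def by blast
  note PR = matrix_inv_inverse[OF P]
  \<comment> \<open>All diagonal entries of \<open>D\<close> are eigenvalues, hence share one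
    modulus; \<open>undefined\<close> is just an arbitrary index at which to read it off.\<close>
  define r where "r = cmod (D $ undefined $ undefined)"
  have r: "cmod (D $ k $ k) = r" for k
    using assms(1) eigenvalue_diagonalized[OF P D] unfolding isotropic_def A r_def by blast
  have "det P * det (matrix_inv P) = 1"
    by (metis PR(1) det_I det_mul)
  then have "complex_of_real (det A) = det D"
    unfolding det_map_matrix_of_real[symmetric] A det_mul by (simp add: algebra_simps)
  also have "\<dots> = (\<Prod>k\<in>UNIV. D $ k $ k)"
    using D by (intro det_diagonal) (auto simp: diagonal_matrix_def)
  \<comment> \<open>The determinant has modulus r^d, where d is the dimension; as r \<ge> 0 and d >
    0, the value 1 forces r = 1.\<close>
  finally have "cmod (complex_of_real (det A)) = r ^ CARD('n)"
    by (simp add: r flip: prod_norm)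
  then have "r ^ CARD('n) = 1"
    using assms(2) by simp
  then have "r = 1"
    by (metis norm_ge_zero power_eq_1_iff r_def real_norm_def abs_of_nonneg zero_less_card_finite less_irrefl)
  \<comment> \<open>\<open>L\<close> gives the coordinates of a real vector in the complex
    eigenbasis formed by the columns of \<open>P\<close>. There \<open>A\<close> acts as
    \<open>D\<close>, which only rotates each coordinate. The target is used as a real Euclidean
    space, with the real part of the Hermitian product as inner product.\<close>
  define L :: "real^'n \<Rightarrow> complex^'n" where "L x = matrix_inv P *v (\<chi> i. of_real (x $ i))" for x
  have "linear (\<lambda>x :: real^'n. \<chi> i. complex_of_real (x $ i))"
    by (rule linearI) (simp_all add: vec_eq_iff complex_eq_iff)
  then have "linear L"
    unfolding L_def using linear_compose[OF _ matrix_vector_mul_linear, unfolded o_def] by blast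
  moreover have "inj L"
  proof (rule injI)
    fix x y assume "L x = L y"
    then have "P *v L x = P *v L y" by simp
    then show "x = y"
      by (simp add: L_def matrix_vector_mul_assoc PR vec_eq_iff)
  qed
  moreover have "norm (L (A *v x)) = norm (L x)" for x
  proof -
    have "L (A *v x) = D *v L x"
      unfolding L_def map_matrix_of_real_mult_vec[symmetric] A
      by (simp add: matrix_vector_mul_assoc matrix_mul_assoc PR)
    then show ?thesis
      by (simp add: norm_vec_def diagonal_matrix_mult_vec[OF D] norm_mult r \<open>r = 1\<close>)
  qed
  ultimately show ?thesis
    by (rule invariant_inner_imp_orthogonal_conj)
qed

end
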